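(* Let $n\ge1$ and let $Q$ be an $n\times n$-matrix-valued Herglotz function. Then there exist scalar-valued Herglotz functions $q_1,\dots,q_n$ such that $\det Q=q_1\cdots q_n$. If $Q$ is meromorphic on $\mathbb{C}$ (i.e. a meromorphic Herglotz function), then $q_1,\dots,q_n$ can be chosen to be meromorphic Herglotz functions as well.
   Context: $\mathbb{C}_+=\{z\in\mathbb{C}:\operatorname{Im}z>0\}$. For a square complex matrix $M$, $\operatorname{Im}M=\frac1{2i}(M-M^* )$, and $M\ge 0$ means $M$ is positive semi-definite. A function $f$ on $\mathbb{C}\setminus\mathbb{R}$ with values in $\mathbb{C}^{n\times n}$ is $\#$-real if $f(z)=f(\overline z)^*$ for all $z$. A Herglotz function is a function $Q:\mathbb{C}\setminus\mathbb{R}\to\mathbb{C}^{n\times n}$ that is holomorphic, $\#$-real, and satisfies $\operatorname{Im}Q(z)\ge 0$ for all $z\in\mathbb{C}_+$ (scalar-valued means $n=1$; real constants, including $0$, are allowed). If it admits a meromorphic continuation to all of $\mathbb{C}$, it is called a meromorphic Herglotz function. *)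

theory Defs
  imports "HOL-Complex_Analysis.Complex_Analysis"
begin

definition cadjoint :: "complex^'n^'n \<Rightarrow> complex^'n^'n" where
  "cadjoint M = (\<chi> i j. cnj (M $ j $ i))"

definition Im_matrix :: "complex^'n^'n \<Rightarrow> complex^'n^'n" where
  "Im_matrix M = (\<chi> i j. (1 / (2 * \<i>)) * ((M - cadjoint M) $ i $ j))"

definition pos_semidef :: "complex^'n^'n \<Rightarrow> bool" where
  "pos_semidef M \<longleftrightarrow> cadjoint M = M \<and>
     (\<forall>v :: complex^'n. 0 \<le> Re (\<Sum>i\<in>UNIV. cnj (v $ i) * (M *v v) $ i))"

(* Functions are total in HOL; only the values on the complement of the real axis matter.
   Matrix-valued holomorphy and meromorphy are entrywise. *)
definition herglotz :: "(complex \<Rightarrow> complex^'n^'n) \<Rightarrow> bool" where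
  "herglotz Q \<longleftrightarrow>
     (\<forall>i j. (\<lambda>z. Q z $ i $ j) holomorphic_on (- \<real>)) \<and>
     (\<forall>z\<in>- \<real>. Q z = cadjoint (Q (cnj z))) \<and>
     (\<forall>z. Im z > 0 \<longrightarrow> pos_semidef (Im_matrix (Q z)))"

(* The continuation F may take arbitrary values at its poles. *)
definition meromorphic_herglotz :: "(complex \<Rightarrow> complex^'n^'n) \<Rightarrow> bool" where
  "meromorphic_herglotz Q \<longleftrightarrow> herglotz Q \<and>
     (\<exists>F :: complex \<Rightarrow> complex^'n^'n.
        (\<forall>i j. (\<lambda>z. F z $ i $ j) meromorphic_on UNIV) \<and> (\<forall>z\<in>- \<real>. F z = Q z))"

(* Scalar functions are regarded as functions with values in the 1x1 matrices. *)
definition scalar_herglotz :: "(complex \<Rightarrow> complex) \<Rightarrow> bool" where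
  "scalar_herglotz q \<longleftrightarrow> herglotz (\<lambda>z. mat (q z) :: complex^1^1)"

definition scalar_meromorphic_herglotz :: "(complex \<Rightarrow> complex) \<Rightarrow> bool" where
  "scalar_meromorphic_herglotz q \<longleftrightarrow> meromorphic_herglotz (\<lambda>z. mat (q z) :: complex^1^1)"

lemma cadjoint_1x1: "cadjoint (mat a :: complex^1^1) = mat (cnj a)"
  by (simp add: cadjoint_def mat_def vec_eq_iff)

lemma mat_1x1_eq_iff: "(mat a :: complex^1^1) = mat b \<longleftrightarrow> a = b"
  by (simp add: mat_def vec_eq_iff)

lemma Im_matrix_1x1: "Im_matrix (mat a :: complex^1^1) = mat (of_real (Im a))"
  by (simp add: Im_matrix_def cadjoint_def mat_def vec_eq_iff complex_eq_iff)

lemma pos_semidef_1x1: "pos_semidef (mat (of_real x) :: complex^1^1) \<longleftrightarrow> 0 \<le> x"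
proof -
  have eq: "Re (\<Sum>i\<in>UNIV. cnj (v $ i) * ((mat (of_real x) :: complex^1^1) *v v) $ i)
      = x * (cmod (v $ 1))\<^sup>2" for v
    unfolding cmod_power2
    by (simp add: matrix_vector_mult_def mat_def power2_eq_square algebra_simps)
  have "0 \<le> x" if "\<forall>v::complex^1. 0 \<le> x * (cmod (v $ 1))\<^sup>2"
    using that[rule_format, of "\<chi> i. 1"] by simp
  then show ?thesis
    unfolding pos_semidef_def eq cadjoint_1x1 by auto
qed

lemma scalar_herglotz_iff:
  "scalar_herglotz q \<longleftrightarrow>
     q holomorphic_on (- \<real>) \<and> (\<forall>z\<in>- \<real>. q z = cnj (q (cnj z))) \<and>
     (\<forall>z. Im z > 0 \<longrightarrow> Im (q z) \<ge> 0)"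
  by (simp add: scalar_herglotz_def herglotz_def cadjoint_1x1 mat_1x1_eq_iff
        Im_matrix_1x1 pos_semidef_1x1) (simp add: mat_def)

lemma scalar_meromorphic_herglotz_iff:
  "scalar_meromorphic_herglotz q \<longleftrightarrow>
     scalar_herglotz q \<and> (\<exists>f. f meromorphic_on UNIV \<and> (\<forall>z\<in>- \<real>. f z = q z))"
    (is "?L \<longleftrightarrow> ?R")
proof
  assume ?L
  then obtain F :: "complex \<Rightarrow> complex^1^1" where
    "scalar_herglotz q" "(\<lambda>z. F z $ 1 $ 1) meromorphic_on UNIV" "\<forall>z\<in>- \<real>. F z = mat (q z)"
    unfolding scalar_meromorphic_herglotz_def meromorphic_herglotz_def scalar_herglotz_def
    by blast
  then show ?R
    by (intro conjI exI[of _ "\<lambda>z. F z $ 1 $ 1"]) (auto simp: mat_def)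
next
  assume ?R
  then obtain f where f: "scalar_herglotz q" "f meromorphic_on UNIV" "\<forall>z\<in>- \<real>. f z = q z"
    by blast
  then show ?L
    unfolding scalar_meromorphic_herglotz_def meromorphic_herglotz_def scalar_herglotz_def
    by (intro conjI exI[of _ "\<lambda>z. mat (f z) :: complex^1^1"]) (auto simp: mat_def)
qed

end

theory Submission
  imports Defs
begin

text \<open>
  The factors come from Gaussian elimination, one pivot at a time. If a diagonal entry
  \<open>f = Q\<^sub>a\<^sub>a\<close> is not identically zero, it is a scalar Herglotz function without zeros off the real
  axis, and \<open>det Q = f \<cdot> det S\<close> where \<open>S\<close> is the Schur complement of that entry. The point is that
  \<open>S\<close> is again a Herglotz function: extending a vector \<open>w\<close> on the remaining coordinates by the
  \<open>a\<close>-th entry that makes \<open>(Q u)\<^sub>a = 0\<close> yields a vector \<open>u\<close> with \<open>u\<^sup>* Q u = w\<^sup>* S w\<close>, so that the imaginary part of the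
  form of \<open>S\<close> inherits its sign from \<open>Q\<close> (\<open>herm_form_schur_complement\<close>). Iterating splits off
  \<open>n\<close> scalar factors.

  All diagonal entries may vanish identically although \<open>det Q\<close> does not, as for the constant matrix
  with rows \<open>(0, 1)\<close> and \<open>(1, 0)\<close>. But if row \<open>a\<close> of \<open>Q(z\<^sub>0)\<close> is nonzero, polarization provides
  a vector \<open>v\<close> with \<open>v\<^sub>a = 1\<close> and \<open>v\<^sup>* Q(z\<^sub>0) v \<noteq> 0\<close>, and passing from \<open>Q\<close> to \<open>P\<^sup>* Q P\<close> with a constant matrix \<open>P\<close> of determinant 1
  that has \<open>v\<close> as its \<open>a\<close>-th column makes this number the diagonal entry at \<open>z\<^sub>0\<close>, while neither the
  Herglotz property nor the determinant is affected.

  The pivots are rational expressions in the entries of \<open>Q\<close>, so meromorphic continuation passes from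
  \<open>Q\<close> to all factors, and the same factorization serves both claims.
\<close>

section \<open>The sesquilinear form of a matrix\<close>

definition herm_form :: "complex^'n^'n \<Rightarrow> complex^'n \<Rightarrow> complex" where
  "herm_form M v = (\<Sum>i\<in>UNIV. cnj (v $ i) * (M *v v) $ i)"

lemma herm_form_sum:
  "herm_form M v = (\<Sum>i\<in>UNIV. \<Sum>j\<in>UNIV. cnj (v $ i) * M $ i $ j * v $ j)"
  by (simp add: herm_form_def matrix_vector_mult_def sum_distrib_left mult_ac)

lemma herm_form_cadjoint: "herm_form (cadjoint M) v = cnj (herm_form M v)"
  unfolding herm_form_sum cadjoint_def
  by (subst sum.swap) (simp add: mult_ac)

lemma herm_form_Im_matrix: "herm_form (Im_matrix M) v = of_real (Im (herm_form M v))"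
proof -
  have "herm_form (Im_matrix M) v
      = (1 / (2 * \<i>)) * (herm_form M v - herm_form (cadjoint M) v)"
    unfolding herm_form_sum Im_matrix_def
    by (simp add: sum_distrib_left sum_subtractf[symmetric] algebra_simps)
  also have "\<dots> = of_real (Im (herm_form M v))"
    by (simp add: herm_form_cadjoint complex_eq_iff)
  finally show ?thesis .
qed

lemma pos_semidef_Im_matrix_iff: "pos_semidef (Im_matrix M) \<longleftrightarrow> (\<forall>v. 0 \<le> Im (herm_form M v))"
proof -
  have "cnj ((M $ j $ i - cnj (M $ i $ j)) / (2 * \<i>)) = (M $ i $ j - cnj (M $ j $ i)) / (2 * \<i>)"
    for i j
    by (simp add: complex_eq_iff add_divide_distrib diff_divide_distrib)
  then have "cadjoint (Im_matrix M) = Im_matrix M"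
    by (simp add: Im_matrix_def cadjoint_def vec_eq_iff)
  then show ?thesis
    by (simp add: pos_semidef_def herm_form_Im_matrix flip: herm_form_def)
qed

lemma herm_form_congruence: "herm_form (cadjoint P ** M ** P) v = herm_form M (P *v v)"
proof -
  have adj: "(\<Sum>i\<in>UNIV. cnj (v $ i) * (cadjoint P *v y) $ i) = (\<Sum>k\<in>UNIV. cnj ((P *v v) $ k) * y $ k)"
    for y
    unfolding matrix_vector_mult_def cadjoint_def
    by (simp add: sum_distrib_left sum_distrib_right mult_ac, subst sum.swap, rule refl)
  show ?thesis
    unfolding herm_form_def by (simp add: adj flip: matrix_vector_mul_assoc)
qed

lemma matrix_vector_mult_axis:
  fixes A :: "'a::semiring_1^'n^'m"
  shows "A *v axis a 1 = column a A"
  by (simp add: matrix_vector_mult_def axis_def column_def vec_eq_iff if_distrib cong: if_cong)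

lemma herm_form_axis: "herm_form M (axis a 1) = M $ a $ a"
proof -
  have "herm_form M (axis a 1) = (\<Sum>i\<in>UNIV. if i = a then M $ a $ a else 0)"
    unfolding herm_form_def matrix_vector_mult_axis
    by (intro sum.cong refl) (simp add: axis_def column_def)
  then show ?thesis by simp
qed

lemma herm_form_two_axes:
  assumes "a \<noteq> b"
  shows "herm_form M (axis a 1 + axis b c)
    = M $ a $ a + c * M $ a $ b + cnj c * M $ b $ a + cnj c * c * M $ b $ b"
proof -
  have split: "(\<Sum>i\<in>UNIV. f i) = f a + f b" if "\<And>i. i \<noteq> a \<Longrightarrow> i \<noteq> b \<Longrightarrow> f i = 0"
    for f :: "'a \<Rightarrow> complex"
  proof -
    have "(\<Sum>i\<in>UNIV. f i) = (\<Sum>i\<in>{a, b}. f i)"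
      using that by (intro sum.mono_neutral_right) auto
    then show ?thesis using assms by simp
  qed
  show ?thesis
    unfolding herm_form_sum using assms
    by (simp add: split axis_def algebra_simps)
qed

text \<open>
  Polarization, with control over the support and one entry of the vector: these are what allow
  the vector to become a column of a unimodular matrix that acts on few coordinates.
\<close>

lemma exists_herm_form_nonzero:
  fixes M :: "complex^'n^'n"
  assumes "M $ a $ b \<noteq> 0"
  shows "\<exists>v. v $ a = 1 \<and> (\<forall>i. i \<noteq> a \<longrightarrow> i \<noteq> b \<longrightarrow> v $ i = 0) \<and> herm_form M v \<noteq> 0"
proof (cases "M $ a $ a = 0")
  case False
  then show ?thesis
    by (intro exI[of _ "axis a 1"] conjI) (simp_all only: herm_form_axis, simp_all add: axis_def)
next
  case True
  with assms have ab: "a \<noteq> b" by auto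
  have "\<exists>c. herm_form M (axis a 1 + axis b c) \<noteq> 0"
  proof (rule ccontr)
    assume "\<not> ?thesis"
    then have z: "c * M $ a $ b + cnj c * M $ b $ a + cnj c * c * M $ b $ b = 0" for c
      using herm_form_two_axes[OF ab, of M c] True by auto
    \<comment> \<open>The signs give \<open>M\<^sub>b\<^sub>b = 0\<close> and \<open>M\<^sub>a\<^sub>b = - M\<^sub>b\<^sub>a\<close>, the imaginary unit gives \<open>M\<^sub>a\<^sub>b = M\<^sub>b\<^sub>a\<close>.\<close>
    from z[of 1] z[of "-1"] z[of \<i>] have "M $ a $ b = 0"
      by (auto simp: complex_eq_iff)
    with assms show False by simp
  qed
  then obtain c where "herm_form M (axis a 1 + axis b c) \<noteq> 0" by blast
  then show ?thesis
    using ab by (intro exI[of _ "axis a 1 + axis b c"] conjI) (simp_all only:, simp_all add: axis_def)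
qed

section \<open>Herglotz functions\<close>

lemma herglotz_iff_form:
  fixes Q :: "complex \<Rightarrow> complex^'n^'n"
  shows "herglotz Q \<longleftrightarrow>
     (\<forall>i j. (\<lambda>z. Q z $ i $ j) holomorphic_on (- \<real>)) \<and>
     (\<forall>z\<in>- \<real>. Q z = cadjoint (Q (cnj z))) \<and>
     (\<forall>z v. Im z > 0 \<longrightarrow> 0 \<le> Im (herm_form (Q z) v))"
  by (auto simp: herglotz_def pos_semidef_Im_matrix_iff)

lemma scalar_herglotz_diagonal:
  fixes Q :: "complex \<Rightarrow> complex^'n^'n"
  assumes "herglotz Q"
  shows "scalar_herglotz (\<lambda>z. Q z $ a $ a)"
proof -
  have "Q z $ a $ a = cnj (Q (cnj z) $ a $ a)" if "z \<in> - \<real>" for z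
  proof -
    have "Q z $ a $ a = cadjoint (Q (cnj z)) $ a $ a"
      using assms that by (metis herglotz_iff_form)
    then show ?thesis by (simp add: cadjoint_def)
  qed
  moreover have "0 \<le> Im (Q z $ a $ a)" if "Im z > 0" for z
    using assms that herm_form_axis[of "Q z" a] by (metis herglotz_iff_form)
  ultimately show ?thesis
    using assms by (auto simp: scalar_herglotz_iff herglotz_iff_form)
qed

text \<open>
  Both half-planes are covered by the symmetry \<open>f(z) = cnj (f (cnj z))\<close>, and on the upper one a
  nonconstant \<open>f\<close> is an open map: if it took the value 0, it would also take values with negative
  imaginary part.
\<close>

lemma scalar_herglotz_nonzero:
  assumes f: "scalar_herglotz f" and z0: "z0 \<in> - \<real>" "f z0 \<noteq> 0" and z: "z \<in> - \<real>"
  shows "f z \<noteq> 0"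
proof
  assume fz: "f z = 0"
  have upper: "\<exists>w'. Im w' > 0 \<and> (f w' = 0 \<longleftrightarrow> f w = 0)" if "w \<in> - \<real>" for w
  proof (cases "Im w > 0")
    case False
    with that have "Im (cnj w) > 0"
      by (auto simp: complex_is_Real_iff)
    moreover have "f w = cnj (f (cnj w))"
      using f that by (auto simp: scalar_herglotz_iff)
    ultimately show ?thesis by (metis complex_cnj_zero_iff)
  qed auto
  obtain z1 where z1: "Im z1 > 0" "f z1 = 0"
    using upper[OF z] fz by auto
  obtain z2 where z2: "Im z2 > 0" "f z2 \<noteq> 0"
    using upper[OF z0(1)] z0(2) by auto
  let ?U = "{z. Im z > 0}"
  have "?U \<subseteq> - \<real>"
    by (auto simp: complex_is_Real_iff)
  then have hol: "f holomorphic_on ?U"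
    using f by (auto simp: scalar_herglotz_iff intro: holomorphic_on_subset)
  have U: "open ?U" "connected ?U"
    by (auto simp: open_halfspace_Im_gt convex_halfspace_Im_gt intro: convex_connected)
  have "\<not> f constant_on ?U"
    using z1 z2 unfolding constant_on_def by (metis mem_Collect_eq)
  then have "open (f ` ?U)"
    using open_mapping_thm[OF hol U U(1)] by auto
  moreover have "0 \<in> f ` ?U"
    using z1 by force
  ultimately obtain e where e: "e > 0" "ball 0 e \<subseteq> f ` ?U"
    using open_contains_ball by blast
  have "- \<i> * of_real (e / 2) \<in> ball 0 e"
    using e by (simp add: norm_mult)
  then obtain w where w: "Im w > 0" "f w = - \<i> * of_real (e / 2)"
    using e by (metis (mono_tags, lifting) imageE mem_Collect_eq subsetD)
  then have "Im (f w) < 0" using e by simp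
  with f w(1) show False by (force simp: scalar_herglotz_iff)
qed

text \<open>
  The existence of a meromorphic continuation, rather than meromorphy itself, is what the algebraic
  operations have to preserve: the functions below have arbitrary values on the real axis.
\<close>

definition continuable :: "(complex \<Rightarrow> complex) \<Rightarrow> bool" where
  "continuable f \<longleftrightarrow> (\<exists>g. g meromorphic_on UNIV \<and> (\<forall>z\<in>- \<real>. g z = f z))"

lemma continuable_const: "continuable (\<lambda>_. c)"
  unfolding continuable_def by (intro exI[of _ "\<lambda>_. c"]) (auto intro: meromorphic_intros)

lemma continuable_diff: "continuable f \<Longrightarrow> continuable g \<Longrightarrow> continuable (\<lambda>z. f z - g z)"
  unfolding continuable_def
  by (elim exE conjE, rename_tac F G, rule_tac x = "\<lambda>z. F z - G z" in exI)
     (auto intro: meromorphic_intros)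

lemma continuable_mult: "continuable f \<Longrightarrow> continuable g \<Longrightarrow> continuable (\<lambda>z. f z * g z)"
  unfolding continuable_def
  by (elim exE conjE, rename_tac F G, rule_tac x = "\<lambda>z. F z * G z" in exI)
     (auto intro: meromorphic_intros)

lemma continuable_divide: "continuable f \<Longrightarrow> continuable g \<Longrightarrow> continuable (\<lambda>z. f z / g z)"
  unfolding continuable_def
  by (elim exE conjE, rename_tac F G, rule_tac x = "\<lambda>z. F z / G z" in exI)
     (auto intro: meromorphic_intros)

lemma continuable_sum:
  assumes "\<And>i. i \<in> A \<Longrightarrow> continuable (f i)"
  shows "continuable (\<lambda>z. \<Sum>i\<in>A. f i z)"
proof -
  obtain g where "\<And>i. i \<in> A \<Longrightarrow> g i meromorphic_on UNIV \<and> (\<forall>z\<in>- \<real>. g i z = f i z)"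
    using assms unfolding continuable_def by metis
  then show ?thesis
    unfolding continuable_def
    by (intro exI[of _ "\<lambda>z. \<Sum>i\<in>A. g i z"]) (auto intro!: meromorphic_intros)
qed

lemmas continuable_intros =
  continuable_const continuable_diff continuable_mult continuable_divide continuable_sum

lemma meromorphic_herglotz_iff:
  fixes Q :: "complex \<Rightarrow> complex^'n^'n"
  shows "meromorphic_herglotz Q \<longleftrightarrow> herglotz Q \<and> (\<forall>i j. continuable (\<lambda>z. Q z $ i $ j))"
proof (intro iffI conjI allI)
  fix i j :: 'n
  assume "meromorphic_herglotz Q"
  then obtain F :: "complex \<Rightarrow> complex^'n^'n"
    where "\<forall>i j. (\<lambda>z. F z $ i $ j) meromorphic_on UNIV" "\<forall>z\<in>- \<real>. F z = Q z"
    by (auto simp: meromorphic_herglotz_def)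
  then show "continuable (\<lambda>z. Q z $ i $ j)"
    unfolding continuable_def by (intro exI[of _ "\<lambda>z. F z $ i $ j"]) auto
next
  assume R: "herglotz Q \<and> (\<forall>i j. continuable (\<lambda>z. Q z $ i $ j))"
  then obtain G where "\<And>i j. G i j meromorphic_on UNIV \<and> (\<forall>z\<in>- \<real>. G i j z = Q z $ i $ j)"
    unfolding continuable_def by metis
  with R show "meromorphic_herglotz Q"
    unfolding meromorphic_herglotz_def
    by (intro conjI exI[of _ "\<lambda>z. \<chi> i j. G i j z"]) (auto simp: vec_eq_iff)
qed (simp add: meromorphic_herglotz_def)

lemma scalar_meromorphic_herglotz_iff_continuable:
  "scalar_meromorphic_herglotz q \<longleftrightarrow> scalar_herglotz q \<and> continuable q"
  by (simp add: scalar_meromorphic_herglotz_iff continuable_def)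

lemma herglotz_congruence:
  fixes Q :: "complex \<Rightarrow> complex^'n^'n"
  assumes "herglotz Q"
  shows "herglotz (\<lambda>z. cadjoint P ** Q z ** P)"
  unfolding herglotz_iff_form
proof (intro conjI allI ballI impI)
  fix i j
  show "(\<lambda>z. (cadjoint P ** Q z ** P) $ i $ j) holomorphic_on - \<real>"
    using assms unfolding herglotz_iff_form matrix_matrix_mult_def
    by (auto intro!: holomorphic_intros)
next
  fix z :: complex
  assume "z \<in> - \<real>"
  then have "Q z = cadjoint (Q (cnj z))"
    using assms by (simp add: herglotz_iff_form)
  moreover have adj_mult: "cadjoint (A ** B) = cadjoint B ** cadjoint A" for A B :: "complex^'n^'n"
    by (simp add: cadjoint_def matrix_matrix_mult_def vec_eq_iff mult_ac)
  moreover have "cadjoint (cadjoint P) = P"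
    by (simp add: cadjoint_def vec_eq_iff)
  ultimately show "cadjoint P ** Q z ** P = cadjoint (cadjoint P ** Q (cnj z) ** P)"
    by (simp add: matrix_mul_assoc)
next
  fix z :: complex and v
  assume "0 < Im z"
  with assms show "0 \<le> Im (herm_form (cadjoint P ** Q z ** P) v)"
    unfolding herm_form_congruence by (simp add: herglotz_iff_form)
qed

lemma meromorphic_herglotz_congruence:
  fixes Q :: "complex \<Rightarrow> complex^'n^'n"
  assumes "meromorphic_herglotz Q"
  shows "meromorphic_herglotz (\<lambda>z. cadjoint P ** Q z ** P)"
  unfolding meromorphic_herglotz_iff
proof (intro conjI allI)
  show "herglotz (\<lambda>z. cadjoint P ** Q z ** P)"
    using assms by (simp add: meromorphic_herglotz_iff herglotz_congruence)
  show "continuable (\<lambda>z. (cadjoint P ** Q z ** P) $ i $ j)" for i j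
    using assms unfolding meromorphic_herglotz_iff
    by (auto simp: matrix_matrix_mult_def intro!: continuable_intros)
qed

section \<open>Schur complements\<close>

text \<open>
  The eliminated row and column are replaced by those of the identity matrix instead of being
  deleted, so that the elimination can be iterated within one matrix type.
\<close>

definition schur_complement :: "'n \<Rightarrow> 'a::field^'n^'n \<Rightarrow> 'a^'n^'n" where
  "schur_complement a M = (\<chi> i j. if i = a \<or> j = a then (if i = j then 1 else 0)
     else M $ i $ j - M $ i $ a * M $ a $ j / M $ a $ a)"

definition replace_column :: "'n \<Rightarrow> 'a::field^'n \<Rightarrow> 'a^'n^'n" where
  "replace_column a v = (\<chi> i j. if j = a then v $ i else if i = j then 1 else 0)"

text \<open>This is Cramer's rule for the identity matrix.\<close>

lemma det_replace_column:
  fixes v :: "'a::field^'n"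
  shows "det (replace_column a v) = v $ a"
proof -
  have "replace_column a v
      = (\<chi> i j. if j = a then (mat 1 *v v) $ i else (mat 1 :: 'a^'n^'n) $ i $ j)"
    by (simp only: replace_column_def vec_eq_iff matrix_vector_mul_lid) (simp add: mat_def)
  then show ?thesis
    using cramer_lemma[of a "mat 1" v] by simp
qed

lemma replace_column_axis: "replace_column a v *v axis a 1 = v"
  by (simp add: replace_column_def matrix_vector_mult_axis column_def vec_eq_iff)

text \<open>
  One step of Gaussian elimination is a factorization \<open>M = L S R\<close>, where \<open>L\<close> and \<open>R\<close> are
  unipotent and \<open>S\<close> is the Schur complement with the pivot put back into its diagonal place.
\<close>

lemma det_schur_complement:
  fixes M :: "'a::field^'n^'n"
  assumes nz: "M $ a $ a \<noteq> 0"
  shows "det M = M $ a $ a * det (schur_complement a M)"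
proof -
  define L where "L = replace_column a (\<chi> i. M $ i $ a / M $ a $ a)"
  define R where "R = transpose (replace_column a (\<chi> j. M $ a $ j / M $ a $ a))"
  define S where "S = (\<chi> i. if i = a then M $ a $ a *s axis a 1 else schur_complement a M $ i)"
  have L: "L $ i $ j = (if j = a then M $ i $ a / M $ a $ a else if i = j then 1 else 0)" for i j
    by (simp add: L_def replace_column_def)
  have R: "R $ i $ j = (if i = a then M $ a $ j / M $ a $ a else if i = j then 1 else 0)" for i j
    by (auto simp: R_def replace_column_def transpose_def)
  have S: "S $ i $ j = (if i = a \<or> j = a then (if i = j then M $ a $ a else 0)
     else M $ i $ j - M $ i $ a * M $ a $ j / M $ a $ a)" for i j
    by (auto simp: S_def schur_complement_def axis_def)
  have SR: "(S ** R) $ i $ j = (if i = a then M $ a $ j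
     else if j = a then 0 else S $ i $ j)" for i j
  proof -
    have "(S ** R) $ i $ j = (\<Sum>k\<in>UNIV. (if k = a then S $ i $ a * (M $ a $ j / M $ a $ a) else 0)
        + (if k = j \<and> k \<noteq> a then S $ i $ j else 0))"
      unfolding matrix_matrix_mult_def vec_lambda_beta by (intro sum.cong) (auto simp: R)
    also have "\<dots> = S $ i $ a * (M $ a $ j / M $ a $ a) + (if j = a then 0 else S $ i $ j)"
      by (cases "j = a") (simp_all add: sum.distrib cong: conj_cong)
    finally show ?thesis using nz by (auto simp: S)
  qed
  have "(L ** (S ** R)) $ i $ j = M $ i $ j" for i j
  proof -
    have "(L ** (S ** R)) $ i $ j = (\<Sum>k\<in>UNIV. (if k = a then M $ i $ a / M $ a $ a * (S ** R) $ a $ j else 0)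
        + (if k = i \<and> k \<noteq> a then (S ** R) $ i $ j else 0))"
      unfolding matrix_matrix_mult_def[of L] vec_lambda_beta by (intro sum.cong) (auto simp: L)
    also have "\<dots> = M $ i $ a / M $ a $ a * (S ** R) $ a $ j + (if i = a then 0 else (S ** R) $ i $ j)"
      by (cases "i = a") (simp_all add: sum.distrib cong: conj_cong)
    finally show ?thesis using nz by (auto simp: S SR)
  qed
  then have "M = L ** (S ** R)"
    by (simp add: vec_eq_iff)
  then have "det M = det L * det S * det R"
    by (metis det_mul mult.assoc)
  moreover have "det L = 1" "det R = 1"
    using nz by (simp_all add: L_def R_def det_replace_column)
  moreover have "det S = M $ a $ a * det (\<chi> i. if i = a then axis a 1 else schur_complement a M $ i)"
    unfolding S_def by (rule det_row_mul)
  moreover have "(\<chi> i. if i = a then axis a 1 else schur_complement a M $ i) = schur_complement a M"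
    by (simp add: vec_eq_iff schur_complement_def axis_def)
  ultimately show ?thesis by simp
qed

text \<open>
  The vector \<open>u\<close> agrees with \<open>w\<close> except at \<open>a\<close>, where it is chosen such that \<open>(M u)\<^sub>a = 0\<close>. Then
  \<open>M u\<close> and \<open>S w\<close> agree outside \<open>a\<close>, and the entry \<open>u\<^sub>a\<close> does not contribute to the form. The last
  summand, which is real, comes from the 1 that replaces the pivot.
\<close>

lemma herm_form_schur_complement:
  fixes M :: "complex^'n^'n"
  assumes nz: "M $ a $ a \<noteq> 0"
  obtains u where
    "herm_form (schur_complement a M) w = herm_form M u + of_real ((cmod (w $ a))\<^sup>2)"
proof -
  define s where "s = (\<Sum>j\<in>UNIV - {a}. M $ a $ j * w $ j)"
  define u where "u = (\<chi> i. if i = a then - (s / M $ a $ a) else w $ i)"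
  have split: "(\<Sum>i\<in>UNIV. f i) = f a + (\<Sum>i\<in>UNIV - {a}. f i)" for f :: "'n \<Rightarrow> complex"
    by (simp add: sum.remove)
  have Mu: "(M *v u) $ i = (\<Sum>j\<in>UNIV - {a}. M $ i $ j * w $ j) - M $ i $ a * (s / M $ a $ a)" for i
    unfolding matrix_vector_mult_def
    by (simp add: split u_def)
  then have Mu_a: "(M *v u) $ a = 0"
    using nz by (simp add: s_def)
  have Sw: "(schur_complement a M *v w) $ i = (M *v u) $ i" if "i \<noteq> a" for i
  proof -
    have "(schur_complement a M *v w) $ i
        = (\<Sum>j\<in>UNIV - {a}. M $ i $ j * w $ j - M $ i $ a / M $ a $ a * (M $ a $ j * w $ j))"
      using that unfolding matrix_vector_mult_def
      by (simp add: split schur_complement_def, intro sum.cong) (auto simp: field_simps)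
    also have "\<dots> = (M *v u) $ i"
      unfolding Mu s_def by (simp add: sum_subtractf sum_distrib_left sum_divide_distrib)
    finally show ?thesis .
  qed
  have Sw_a: "(schur_complement a M *v w) $ a = w $ a"
    unfolding matrix_vector_mult_def by (simp add: split schur_complement_def)
  have "herm_form (schur_complement a M) w
      = (\<Sum>i\<in>UNIV - {a}. cnj (w $ i) * (M *v u) $ i) + cnj (w $ a) * w $ a"
    unfolding herm_form_def by (simp add: split Sw Sw_a)
  moreover have "herm_form M u = (\<Sum>i\<in>UNIV - {a}. cnj (w $ i) * (M *v u) $ i)"
    unfolding herm_form_def by (simp add: split Mu_a) (simp add: u_def)
  moreover have "cnj (w $ a) * w $ a = of_real ((cmod (w $ a))\<^sup>2)"
    by (simp add: complex_norm_square mult.commute del: of_real_power)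
  ultimately show ?thesis
    by (intro that[of u]) (simp only:)
qed

lemma herglotz_schur_complement:
  fixes Q :: "complex \<Rightarrow> complex^'n^'n"
  assumes Q: "herglotz Q" and nz: "\<And>z. z \<in> - \<real> \<Longrightarrow> Q z $ a $ a \<noteq> 0"
  shows "herglotz (\<lambda>z. schur_complement a (Q z))"
  unfolding herglotz_iff_form
proof (intro conjI allI ballI impI)
  fix i j
  show "(\<lambda>z. schur_complement a (Q z) $ i $ j) holomorphic_on - \<real>"
    using Q nz unfolding herglotz_iff_form schur_complement_def
    by (cases "i = a \<or> j = a") (auto intro!: holomorphic_intros)
next
  fix z :: complex
  assume "z \<in> - \<real>"
  then have "Q z = cadjoint (Q (cnj z))"
    using Q by (simp add: herglotz_iff_form)
  then have "Q z $ i $ j = cnj (Q (cnj z) $ j $ i)" for i j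
    by (simp add: cadjoint_def vec_eq_iff)
  then show "schur_complement a (Q z) = cadjoint (schur_complement a (Q (cnj z)))"
    by (auto simp: schur_complement_def cadjoint_def vec_eq_iff mult_ac)
next
  fix z :: complex and w
  assume z: "0 < Im z"
  then have "z \<in> - \<real>"
    by (auto simp: complex_is_Real_iff)
  from herm_form_schur_complement[OF nz[OF this], of w] obtain u where
    "herm_form (schur_complement a (Q z)) w = herm_form (Q z) u + of_real ((cmod (w $ a))\<^sup>2)"
    by blast
  moreover have "0 \<le> Im (herm_form (Q z) u)"
    using Q z by (simp add: herglotz_iff_form)
  ultimately show "0 \<le> Im (herm_form (schur_complement a (Q z)) w)"
    by simp
qed

lemma meromorphic_herglotz_schur_complement:
  fixes Q :: "complex \<Rightarrow> complex^'n^'n"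
  assumes "meromorphic_herglotz Q" and "\<And>z. z \<in> - \<real> \<Longrightarrow> Q z $ a $ a \<noteq> 0"
  shows "meromorphic_herglotz (\<lambda>z. schur_complement a (Q z))"
  unfolding meromorphic_herglotz_iff
proof (intro conjI allI)
  show "herglotz (\<lambda>z. schur_complement a (Q z))"
    using assms by (auto simp: meromorphic_herglotz_iff intro: herglotz_schur_complement)
  show "continuable (\<lambda>z. schur_complement a (Q z) $ i $ j)" for i j
    using assms(1) unfolding meromorphic_herglotz_iff schur_complement_def
    by (cases "i = a \<or> j = a") (auto intro!: continuable_intros)
qed

section \<open>Factorization of the determinant\<close>

text \<open>
  A matrix of size \<open>card I\<close>, padded by an identity block. The induction on the size of the matrix
  becomes an induction on \<open>card I\<close>.
\<close>

definition trivial_off :: "'n set \<Rightarrow> complex^'n^'n \<Rightarrow> bool" where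
  "trivial_off I M \<longleftrightarrow> (\<forall>i j. i \<notin> I \<or> j \<notin> I \<longrightarrow> M $ i $ j = (if i = j then 1 else 0))"

lemma trivial_off_schur_complement:
  assumes "trivial_off I M"
  shows "trivial_off (I - {a}) (schur_complement a M)"
  using assms by (auto simp: trivial_off_def schur_complement_def)

lemma trivial_off_mult:
  assumes A: "trivial_off I A" and B: "trivial_off I B"
  shows "trivial_off I (A ** B)"
  unfolding trivial_off_def
proof (intro allI impI)
  fix i j
  assume "i \<notin> I \<or> j \<notin> I"
  then consider "i \<notin> I" | "j \<notin> I" by blast
  then show "(A ** B) $ i $ j = (if i = j then 1 else 0)"
  proof cases
    case 1
    then have "(A ** B) $ i $ j = (\<Sum>k\<in>UNIV. if k = i then B $ i $ j else 0)"
      using A unfolding matrix_matrix_mult_def trivial_off_def vec_lambda_beta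
      by (intro sum.cong) auto
    with 1 B show ?thesis by (simp add: trivial_off_def)
  next
    case 2
    then have "(A ** B) $ i $ j = (\<Sum>k\<in>UNIV. if k = j then A $ i $ j else 0)"
      using B unfolding matrix_matrix_mult_def trivial_off_def vec_lambda_beta
      by (intro sum.cong) auto
    with 2 A show ?thesis by (simp add: trivial_off_def)
  qed
qed

lemma trivial_off_cadjoint: "trivial_off I M \<Longrightarrow> trivial_off I (cadjoint M)"
  by (auto simp: trivial_off_def cadjoint_def)

lemma trivial_off_replace_column:
  "a \<in> I \<Longrightarrow> (\<And>i. i \<notin> I \<Longrightarrow> v $ i = 0) \<Longrightarrow> trivial_off I (replace_column a v)"
  by (auto simp: trivial_off_def replace_column_def)

lemma det_cadjoint: "det (cadjoint M) = cnj (det M)"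
proof -
  have "cadjoint M = transpose (\<chi> i j. cnj (M $ i $ j))"
    by (simp add: cadjoint_def transpose_def vec_eq_iff)
  then have "det (cadjoint M) = det (\<chi> i j. cnj (M $ i $ j))"
    by simp
  also have "\<dots> = cnj (det M)"
    by (simp add: det_def)
  finally show ?thesis .
qed

text \<open>
  One step of the factorization. Row \<open>a\<close> of \<open>Q(z\<^sub>0)\<close> has a nonzero entry, in a column \<open>b\<close> that lies in
  \<open>I\<close> because of the padding; this gives the vector \<open>v\<close> for the congruence by \<open>P\<close>.
\<close>

lemma det_herglotz_split:
  fixes Q :: "complex \<Rightarrow> complex^'n^'n"
  assumes Q: "herglotz Q" and triv: "\<And>z. trivial_off I (Q z)" and a: "a \<in> I"
    and z0: "z0 \<in> - \<real>" "det (Q z0) \<noteq> 0"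
  obtains f S where
    "scalar_herglotz f" "herglotz S" "\<And>z. trivial_off (I - {a}) (S z)"
    "\<And>z. z \<in> - \<real> \<Longrightarrow> det (Q z) = f z * det (S z)"
    "meromorphic_herglotz Q \<Longrightarrow> scalar_meromorphic_herglotz f \<and> meromorphic_herglotz S"
proof -
  have "row a (Q z0) \<noteq> 0"
    using z0(2) det_zero_row(2) by blast
  then obtain b where b: "Q z0 $ a $ b \<noteq> 0"
    by (auto simp: row_def vec_eq_iff)
  with a triv[of z0] have "b \<in> I"
    by (auto simp: trivial_off_def split: if_splits)
  obtain v where v: "v $ a = 1" "\<And>i. i \<noteq> a \<Longrightarrow> i \<noteq> b \<Longrightarrow> v $ i = 0" "herm_form (Q z0) v \<noteq> 0"
    using exists_herm_form_nonzero[OF b] by blast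
  define P where "P = replace_column a v"
  define T where "T z = cadjoint P ** Q z ** P" for z
  have detP: "det P = 1"
    by (simp add: P_def det_replace_column v)
  have detT: "det (T z) = det (Q z)" for z
    by (simp add: T_def det_mul det_cadjoint detP)
  have T: "herglotz T"
    unfolding T_def by (rule herglotz_congruence[OF Q])
  have "T z0 $ a $ a \<noteq> 0"
    using v(3) unfolding T_def
    by (simp add: herm_form_congruence P_def replace_column_axis flip: herm_form_axis)
  then have nz: "T z $ a $ a \<noteq> 0" if "z \<in> - \<real>" for z
    using scalar_herglotz_nonzero[OF scalar_herglotz_diagonal[OF T, of a] z0(1)] that by blast
  have "trivial_off I P"
    unfolding P_def using a v(2) \<open>b \<in> I\<close> by (metis trivial_off_replace_column)
  then have trivT: "trivial_off I (T z)" for z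
    unfolding T_def by (intro trivial_off_mult trivial_off_cadjoint triv)
  show thesis
  proof (rule that[of "\<lambda>z. T z $ a $ a" "\<lambda>z. schur_complement a (T z)"])
    show "det (Q z) = T z $ a $ a * det (schur_complement a (T z))" if "z \<in> - \<real>" for z
      using det_schur_complement[OF nz[OF that]] detT[of z] by simp
    show "scalar_meromorphic_herglotz (\<lambda>z. T z $ a $ a)
        \<and> meromorphic_herglotz (\<lambda>z. schur_complement a (T z))" if "meromorphic_herglotz Q"
    proof -
      have mT: "meromorphic_herglotz T"
        unfolding T_def by (rule meromorphic_herglotz_congruence[OF that])
      then have "meromorphic_herglotz (\<lambda>z. schur_complement a (T z))"
        using nz by (rule meromorphic_herglotz_schur_complement)
      with mT show ?thesis
        using scalar_herglotz_diagonal[OF T, of a]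
        by (auto simp: meromorphic_herglotz_iff scalar_meromorphic_herglotz_iff_continuable)
    qed
  qed (use T nz trivT in \<open>auto intro: scalar_herglotz_diagonal herglotz_schur_complement
      trivial_off_schur_complement\<close>)
qed

text \<open>
  If the determinant vanishes identically there is no pivot, but then all factors can be taken to
  be 0; this is possible since there is at least one of them. Otherwise a pivot is split off.
\<close>

lemma det_herglotz_factorization:
  fixes Q :: "complex \<Rightarrow> complex^'n^'n"
  assumes "card I = m" and "herglotz Q" and "\<And>z. trivial_off I (Q z)"
  shows "\<exists>q. (\<forall>k\<in>{1..m}. scalar_herglotz (q k) \<and>
               (meromorphic_herglotz Q \<longrightarrow> scalar_meromorphic_herglotz (q k))) \<and>
             (\<forall>z\<in>- \<real>. det (Q z) = (\<Prod>k=1..m. q k z))"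
  using assms
proof (induction m arbitrary: I Q)
  case 0
  then have "I = {}" by simp
  then have "Q z = mat 1" for z
    using 0(3)[of z] by (simp add: trivial_off_def mat_def vec_eq_iff)
  then show ?case by simp
next
  case (Suc m)
  obtain a where a: "a \<in> I"
    using Suc.prems(1) by fastforce
  show ?case
  proof (cases "\<exists>z0\<in>- \<real>. det (Q z0) \<noteq> 0")
    case False
    have "scalar_herglotz (\<lambda>_. 0)"
      by (simp add: scalar_herglotz_iff)
    then have "scalar_meromorphic_herglotz (\<lambda>_. 0)"
      by (simp add: scalar_meromorphic_herglotz_iff_continuable continuable_const)
    with False show ?thesis
      using \<open>scalar_herglotz (\<lambda>_. 0)\<close> by (intro exI[of _ "\<lambda>_ _. 0"]) simp
  next
    case True
    then obtain z0 where z0: "z0 \<in> - \<real>" "det (Q z0) \<noteq> 0" by blast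
    obtain f S where fS: "scalar_herglotz f" "herglotz S" "\<And>z. trivial_off (I - {a}) (S z)"
      "\<And>z. z \<in> - \<real> \<Longrightarrow> det (Q z) = f z * det (S z)"
      "meromorphic_herglotz Q \<Longrightarrow> scalar_meromorphic_herglotz f \<and> meromorphic_herglotz S"
      using det_herglotz_split[OF Suc.prems(2,3) a z0] by blast
    have "card (I - {a}) = m"
      using Suc.prems(1) a by simp
    from Suc.IH[OF this fS(2,3)] obtain q where
      q: "\<forall>k\<in>{1..m}. scalar_herglotz (q k) \<and>
            (meromorphic_herglotz S \<longrightarrow> scalar_meromorphic_herglotz (q k))"
         "\<forall>z\<in>- \<real>. det (S z) = (\<Prod>k=1..m. q k z)"
      by blast
    have "det (Q z) = (\<Prod>k=1..Suc m. (q(Suc m := f)) k z)" if "z \<in> - \<real>" for z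
      using that q(2) fS(4) by (simp add: mult.commute)
    then show ?thesis
      using q(1) fS(1,5) by (intro exI[of _ "q(Suc m := f)"]) (auto simp: le_Suc_eq)
  qed
qed

theorem lemma4p1:
  fixes Q :: "complex \<Rightarrow> complex^'n^'n"
  assumes "herglotz Q"
  shows "(\<exists>q :: nat \<Rightarrow> complex \<Rightarrow> complex.
            (\<forall>k\<in>{1..CARD('n)}. scalar_herglotz (q k)) \<and>
            (\<forall>z\<in>- \<real>. det (Q z) = (\<Prod>k=1..CARD('n). q k z)))
       \<and> (meromorphic_herglotz Q \<longrightarrow>
          (\<exists>q :: nat \<Rightarrow> complex \<Rightarrow> complex.
            (\<forall>k\<in>{1..CARD('n)}. scalar_meromorphic_herglotz (q k)) \<and>
            (\<forall>z\<in>- \<real>. det (Q z) = (\<Prod>k=1..CARD('n). q k z))))"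
  using det_herglotz_factorization[OF refl assms, of UNIV]
  by (auto simp: trivial_off_def)

end
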